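(* Let $q\ge3$ be an odd integer. The set of lower equality orders is $$\mathcal L_q=\{\,sQ_k+Q_{k-1}:\ k\ge1 \text{ odd},\ 0\le s<a_{k+1}\,\},$$ and the set of upper equality orders is $$\mathcal U_q=\{\,sQ_k+Q_{k-1}:\ k\ge0 \text{ even},\ 0\le s<a_{k+1},\ (k,s)\ne(0,0)\,\}.$$ Their union $\mathcal L_q\cup\mathcal U_q$ is exactly the set of denominators of all convergents and semiconvergents of $\log_2 q$. The two sets meet only at $r=1$, i.e. $\mathcal L_q\cap\mathcal U_q=\{1\}$.
   Context: For an odd integer $q\ge3$ put $\alpha_q=\log_2 q$ (irrational) and $m_r=\lfloor r\alpha_q\rfloor$. A $q$-admissible word of order $r\ge1$ is a finite word $w=(x_1,\dots,x_L)$ with each $x_j\in\{q/2,\,1/2\}$, containing exactly $r$ occurrences of $q/2$, such that $\prod_{j=1}^{\ell}x_j>1$ for all $1\le \ell<L$ and $\prod_{j=1}^{L}x_j<1$. Let $a_q(r)$ be the number of $q$-admissible words of order $r$. A lower (resp. upper) equality order is an integer $r\ge1$ with $a_q(r)=\frac1r\binom{m_r-1}{r-1}$ (resp. $a_q(r)=\frac1r\binom{m_r}{r-1}$). Write the simple continued fraction $\alpha_q=[a_0;a_1,a_2,\dots]$ and let $P_k/Q_k$ be its $k$-th convergent, with $P_{-1}=1$, $P_0=a_0$, $Q_{-1}=0$, $Q_0=1$, and $P_{k+1}=a_{k+1}P_k+P_{k-1}$, $Q_{k+1}=a_{k+1}Q_k+Q_{k-1}$ for $k\ge0$. (The partial quotients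 $a_k$ are not to be confused with the counts $a_q(r)$.) The convergents are the $P_k/Q_k$ with $k\ge0$; the semiconvergents are the fractions $(sP_k+P_{k-1})/(sQ_k+Q_{k-1})$ with $k\ge0$ and $1\le s<a_{k+1}$. *)

theory Defs
  imports Complex_Main
begin

text \<open>
  Complete quotients of an irrational number \<open>x\<close>. (For rational \<open>x\<close> the expansion
  should stop; here it would continue with junk values because of \<open>1 / 0 = 0\<close>.)
\<close>

primrec cf_quot :: "real \<Rightarrow> nat \<Rightarrow> real" where
  "cf_quot x 0 = x"
| "cf_quot x (Suc k) = 1 / frac (cf_quot x k)"

definition cf_coeff :: "real \<Rightarrow> nat \<Rightarrow> int" where
  "cf_coeff x k = \<lfloor>cf_quot x k\<rfloor>"

text \<open>
  Numerators \<open>P\<close> and denominators \<open>Q\<close> of the convergents, with the index shifted by one so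
  that the conventional starting values at index \<open>-1\<close> are included:
  \<open>cf_num x k\<close> is \<open>P\<close> with index \<open>k - 1\<close>, and \<open>cf_den x k\<close> is \<open>Q\<close> with index \<open>k - 1\<close>.
\<close>

fun cf_num :: "real \<Rightarrow> nat \<Rightarrow> int" where
  "cf_num x 0 = 1"
| "cf_num x (Suc 0) = cf_coeff x 0"
| "cf_num x (Suc (Suc k)) = cf_coeff x (Suc k) * cf_num x (Suc k) + cf_num x k"

fun cf_den :: "real \<Rightarrow> nat \<Rightarrow> int" where
  "cf_den x 0 = 0"
| "cf_den x (Suc 0) = 1"
| "cf_den x (Suc (Suc k)) = cf_coeff x (Suc k) * cf_den x (Suc k) + cf_den x k"

definition convergents :: "real \<Rightarrow> rat set" where
  "convergents x = {Fract (cf_num x (k + 1)) (cf_den x (k + 1)) | k. True}"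

definition semiconvergents :: "real \<Rightarrow> rat set" where
  "semiconvergents x =
     {Fract (s * cf_num x (k + 1) + cf_num x k) (s * cf_den x (k + 1) + cf_den x k) | k s.
        1 \<le> s \<and> s < cf_coeff x (k + 1)}"

text \<open>The denominator of a rational number in lowest terms.\<close>

definition denominator :: "rat \<Rightarrow> int" where
  "denominator y = snd (quotient_of y)"

definition admissible :: "nat \<Rightarrow> nat \<Rightarrow> real list \<Rightarrow> bool" where
  "admissible q r w \<longleftrightarrow>
     set w \<subseteq> {real q / 2, 1 / 2} \<and>
     count_list w (real q / 2) = r \<and>
     (\<forall>l. 1 \<le> l \<and> l < length w \<longrightarrow> prod_list (take l w) > 1) \<and>
     prod_list w < 1"

definition num_admissible :: "nat \<Rightarrow> nat \<Rightarrow> nat" where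
  "num_admissible q r = card {w. admissible q r w}"

text \<open>The largest \<open>k\<close> with \<open>2 ^ k \<le> q ^ r\<close>.\<close>

definition max_halvings :: "nat \<Rightarrow> nat \<Rightarrow> nat" where
  "max_halvings q r = nat \<lfloor>real r * log 2 (real q)\<rfloor>"

definition lower_equality_orders :: "nat \<Rightarrow> nat set" where
  "lower_equality_orders q =
     {r. r \<ge> 1 \<and> real (num_admissible q r) = 1 / real r * real ((max_halvings q r - 1) choose (r - 1))}"

definition upper_equality_orders :: "nat \<Rightarrow> nat set" where
  "upper_equality_orders q =
     {r. r \<ge> 1 \<and> real (num_admissible q r) = 1 / real r * real (max_halvings q r choose (r - 1))}"

end

theory Submission imports Defs begin

text \<open>
  Taking logarithms turns an admissible word into a path with steps \<open>\<alpha> - 1\<close> and \<open>-1\<close> that stays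
  positive until its last step, which is \<open>-1\<close>. Without that step it is a word of length
  \<open>m = \<lfloor>r \<alpha>\<rfloor>\<close> with positive prefixes. By the cycle lemma every word with \<open>r\<close> up-steps and length
  \<open>m\<close> has at least one rotation of this kind, whereas every word of length \<open>m + 1\<close> has at most one
  admissible rotation. Counting pairs of a word and a rotation gives the two bounds. Equality in the
  lower bound means that no word has two good rotations; a second one cuts off a factor with
  \<open>i < r\<close> up-steps and \<open>frac (i \<alpha>) < frac (r \<alpha>)\<close>, and conversely such an \<open>i\<close> allows one to
  concatenate two positive words. So equality holds iff \<open>frac (r \<alpha>)\<close> is smaller than every
  \<open>frac (i \<alpha>)\<close> with \<open>1 \<le> i < r\<close>; for the upper bound the same holds with \<open>- \<alpha>\<close> in place of \<open>\<alpha>\<close>.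
  Such records are attained exactly at the denominators of the convergents and semiconvergents on the
  corresponding side of \<open>\<alpha>\<close>.
\<close>

subsection \<open>Intermediate denominators as records\<close>

text \<open>With \<open>\<beta> = \<alpha>\<close> and \<open>\<beta> = - \<alpha>\<close> this
  expresses best one-sided approximation from below and from above. Order 1 is vacuously a record
  for both signs.\<close>

definition fractional_record :: "real \<Rightarrow> nat \<Rightarrow> bool" where
  "fractional_record \<beta> r \<longleftrightarrow> (\<forall>i. 1 \<le> i \<and> i < r \<longrightarrow> frac (real r * \<beta>) < frac (real i * \<beta>))"

text \<open>The index is shifted as for \<open>cf_num\<close> and \<open>cf_den\<close>, so
  \<open>cf_error x 0 = -1\<close> belongs to the formal convergent 1/0.\<close>

definition cf_error :: "real \<Rightarrow> nat \<Rightarrow> real" where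
  "cf_error x k = of_int (cf_den x k) * x - of_int (cf_num x k)"

lemma cf_error_Suc_Suc:
  "cf_error x (Suc (Suc k)) = of_int (cf_coeff x (Suc k)) * cf_error x (Suc k) + cf_error x k"
  by (simp add: cf_error_def algebra_simps)

lemma cf_det: "cf_num x (Suc k) * cf_den x k - cf_num x k * cf_den x (Suc k) = (-1) ^ Suc k"
  by (induction k) (auto simp: algebra_simps)

lemma frac_le_diff_int:
  fixes y :: real
  assumes "0 \<le> y - of_int p"
  shows "frac y \<le> y - of_int p"
  using assms by (simp add: frac_def le_floor_iff)

text \<open>
  Expand \<open>(r, \<lfloor>r \<beta>\<rfloor>)\<close> in the lattice basis \<open>(A, B)\<close>, \<open>(Q, P)\<close>, whose members lie on opposite
  sides of the line of slope \<open>\<beta>\<close>.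
\<close>
lemma frac_lower_bound_unimodular:
  fixes A B P Q r :: int and \<beta> :: real
  assumes det: "\<bar>A * P - B * Q\<bar> = 1" and "0 \<le> A" "0 < Q"
    and pos: "0 < of_int A * \<beta> - of_int B" and neg: "of_int Q * \<beta> - of_int P < 0"
    and r: "0 < r" "r < A + Q" and irr: "of_int r * \<beta> \<notin> \<int>"
  shows "of_int A * \<beta> - of_int B \<le> frac (of_int r * \<beta>)"
proof (rule ccontr)
  assume less: "\<not> ?thesis"
  define p where "p = \<lfloor>of_int r * \<beta>\<rfloor>"
  \<comment> \<open>Cramer's rule: the determinant \<open>e\<close> is 1 or -1, so dividing by it is
    multiplying by it, and the coordinates \<open>x\<close> and \<open>y\<close> are
    integers.\<close>
  define e where "e = A * P - B * Q"
  define x where "x = e * (r * P - p * Q)"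
  define y where "y = e * (p * A - r * B)"
  have ee: "e * e = 1"
    using det by (metis abs_mult_self_eq e_def mult_1)
  have "x * A + y * Q = (e * e) * r" "x * B + y * P = (e * e) * p"
    unfolding x_def y_def e_def by algebra+
  hence rp: "r = x * A + y * Q" "p = x * B + y * P"
    by (simp_all add: ee)
  have eq: "frac (of_int r * \<beta>)
      = of_int x * (of_int A * \<beta> - of_int B) + of_int y * (of_int Q * \<beta> - of_int P)"
  proof -
    have "frac (of_int r * \<beta>) = of_int r * \<beta> - of_int p"
      by (simp add: frac_def p_def)
    also have "\<dots> = of_int (x * A + y * Q) * \<beta> - of_int (x * B + y * P)"
      using rp by simp
    finally show ?thesis
      by (simp add: algebra_simps)
  qed
  have fpos: "frac (of_int r * \<beta>) > 0"
    using irr frac_gt_0_iff by blast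
  \<comment> \<open>For \<open>x \<le> 0\<close>, positivity of the fractional part forces
    \<open>y < 0\<close>, hence \<open>r < 0\<close>. For \<open>x \<ge> 1\<close>, its assumed
    smallness forces \<open>y \<ge> 1\<close>, hence \<open>r \<ge> A + Q\<close>.\<close>
  show False
  proof (cases "x \<le> 0")
    case True
    hence "of_int x * (of_int A * \<beta> - of_int B) \<le> 0"
      using pos by (simp add: mult_nonpos_nonneg)
    hence "of_int y * (of_int Q * \<beta> - of_int P) > 0"
      using eq fpos by linarith
    hence "y < 0"
      using neg by (simp add: zero_less_mult_iff)
    hence "y * Q < 0" "x * A \<le> 0"
      using True \<open>0 < Q\<close> \<open>0 \<le> A\<close> by (simp_all add: mult_neg_pos mult_nonpos_nonneg)
    thus False
      using rp(1) r(1) by linarith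
  next
    case False
    hence x1: "x \<ge> 1" by simp
    hence "of_int x * (of_int A * \<beta> - of_int B) \<ge> of_int A * \<beta> - of_int B"
      using pos by (simp add: mult_le_cancel_right1)
    hence "of_int y * (of_int Q * \<beta> - of_int P) < 0"
      using eq less by linarith
    hence "y \<ge> 1"
      using neg by (simp add: mult_less_0_iff)
    hence "Q \<le> y * Q" "A \<le> x * A"
      using x1 \<open>0 < Q\<close> \<open>0 \<le> A\<close> by (simp_all add: mult_le_cancel_right1)
    thus False
      using rp(1) r(2) by linarith
  qed
qed

lemma mult_irrational_notin_Ints:
  fixes x :: real
  assumes "x \<notin> \<rat>" "r \<noteq> 0"
  shows "of_int r * x \<notin> \<int>"
proof
  assume "of_int r * x \<in> \<int>"
  then obtain m :: int where "of_int r * x = of_int m" by (auto elim: Ints_cases)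
  hence "x = of_int m / of_int r"
    using assms(2) by (simp add: field_simps)
  thus False using assms(1) by simp
qed

section \<open>Errors of convergents and intermediate fractions\<close>

locale irrational =
  fixes \<alpha> :: real
  assumes irrational: "\<alpha> \<notin> \<rat>"
begin

abbreviation "den \<equiv> cf_den \<alpha>"
abbreviation "num \<equiv> cf_num \<alpha>"
abbreviation "coeff \<equiv> cf_coeff \<alpha>"

lemma mult_notin_Ints:
  assumes "r \<noteq> 0"
  shows "of_int r * \<alpha> \<notin> \<int>"
  using mult_irrational_notin_Ints[OF irrational assms] .

lemma cf_quot_irrational: "cf_quot \<alpha> k \<notin> \<rat>"
proof (induction k)
  case 0
  show ?case using irrational by simp
next
  case (Suc k)
  show ?case
  proof
    assume "cf_quot \<alpha> (Suc k) \<in> \<rat>"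
    hence "inverse (cf_quot \<alpha> (Suc k)) \<in> \<rat>" by (rule Rats_inverse)
    hence "frac (cf_quot \<alpha> k) + of_int \<lfloor>cf_quot \<alpha> k\<rfloor> \<in> \<rat>"
      by (intro Rats_add) simp_all
    thus False using Suc by (simp add: frac_def)
  qed
qed

lemma frac_cf_quot_pos: "frac (cf_quot \<alpha> k) > 0"
  using cf_quot_irrational[of k] by (metis Ints_subset_Rats frac_gt_0_iff subsetD)

lemma cf_quot_Suc_gt_1: "cf_quot \<alpha> (Suc k) > 1"
  using frac_cf_quot_pos[of k] frac_lt_1[of "cf_quot \<alpha> k"] by simp

lemma coeff_Suc_pos: "coeff (Suc k) \<ge> 1"
  using cf_quot_Suc_gt_1[of k] unfolding cf_coeff_def by linarith

lemma den_nonneg: "den k \<ge> 0" and den_Suc_pos: "den (Suc k) \<ge> 1"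
proof -
  have "den k \<ge> 0 \<and> den (Suc k) \<ge> 1"
  proof (induction k)
    case (Suc k)
    have "1 \<le> coeff (Suc k) * den (Suc k)"
      using coeff_Suc_pos[of k] Suc by (simp add: int_one_le_iff_zero_less)
    thus ?case using Suc by simp
  qed simp
  thus "den k \<ge> 0" "den (Suc k) \<ge> 1" by auto
qed

lemma den_Suc_Suc_gt: "den k < den (Suc (Suc k))"
proof -
  have "1 \<le> coeff (Suc k) * den (Suc k)"
    using coeff_Suc_pos[of k] den_Suc_pos[of k] by (simp add: int_one_le_iff_zero_less)
  thus ?thesis by simp
qed

text \<open>Inductively, the recurrence replaces the complete quotient by its fractional part, whose
  reciprocal is the next complete quotient.\<close>

lemma cf_error_quot: "cf_error \<alpha> k = - cf_quot \<alpha> (Suc k) * cf_error \<alpha> (Suc k)"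
proof (induction k)
  case 0
  show ?case using frac_cf_quot_pos[of 0]
    by (simp add: cf_error_def cf_coeff_def frac_def)
next
  case (Suc k)
  have "cf_error \<alpha> (Suc (Suc k)) = - frac (cf_quot \<alpha> (Suc k)) * cf_error \<alpha> (Suc k)"
    unfolding cf_error_Suc_Suc by (subst Suc) (simp add: frac_def cf_coeff_def algebra_simps)
  thus ?case using frac_cf_quot_pos[of "Suc k"] 
    by (simp del: cf_quot.simps add: cf_quot.simps(2)[of _ "Suc k"])
qed

text \<open>The factor in \<open>cf_error_quot\<close> is negative, so the errors alternate in sign,
  starting from -1.\<close>

lemma cf_error_sign: "(-1) ^ Suc k * cf_error \<alpha> k > 0"
proof (induction k)
  case 0
  show ?case by (simp add: cf_error_def)
next
  case (Suc k)
  have "0 < cf_quot \<alpha> (Suc k) * ((-1) ^ Suc (Suc k) * cf_error \<alpha> (Suc k))"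
    using Suc by (subst (asm) cf_error_quot) (simp del: cf_quot.simps add: mult_ac)
  thus ?case
    using cf_quot_Suc_gt_1[of k] by (simp only: zero_less_mult_iff) linarith
qed

text \<open>In conventional indexing this is \<open>s * Q_k + Q_(k-1)\<close>. Here
  \<open>s = 0\<close> gives \<open>den k\<close> and \<open>s = coeff (k + 1)\<close> gives
  \<open>den (k + 2)\<close>.\<close>

definition inter_den :: "nat \<Rightarrow> int \<Rightarrow> int" where
  "inter_den k s = s * den (k + 1) + den k"

definition inter_num :: "nat \<Rightarrow> int \<Rightarrow> int" where
  "inter_num k s = s * num (k + 1) + num k"

text \<open>The sign makes the error positive in the relevant range of \<open>s\<close>: odd
  \<open>k\<close> gives fractions below \<alpha>, even \<open>k\<close> fractions above.\<close>

definition inter_error :: "nat \<Rightarrow> int \<Rightarrow> real" where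
  "inter_error k s = (-1) ^ Suc k * (of_int (inter_den k s) * \<alpha> - of_int (inter_num k s))"

lemma inter_error_eq:
  "inter_error k s = (-1) ^ Suc k * (of_int s * cf_error \<alpha> (Suc k) + cf_error \<alpha> k)"
  by (simp add: inter_error_def inter_den_def inter_num_def cf_error_def algebra_simps)

text \<open>By \<open>cf_error_quot\<close> the error is \<open>cf_quot \<alpha> (k + 1) - s\<close>
  times the absolute error at \<open>k + 1\<close>, and an irrational quotient exceeds its
  floor.\<close>

lemma inter_error_pos:
  assumes "s \<le> coeff (k + 1)"
  shows "inter_error k s > 0"
proof -
  have "of_int s < cf_quot \<alpha> (Suc k)"
  proof -
    have "of_int (coeff (Suc k)) = cf_quot \<alpha> (Suc k) - frac (cf_quot \<alpha> (Suc k))"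
      by (simp add: frac_def cf_coeff_def)
    moreover have "real_of_int s \<le> of_int (coeff (Suc k))"
      using assms by simp
    ultimately show ?thesis using frac_cf_quot_pos[of "Suc k"] by linarith
  qed
  hence "0 < (cf_quot \<alpha> (Suc k) - of_int s) * ((-1) ^ Suc (Suc k) * cf_error \<alpha> (Suc k))"
    using cf_error_sign[of "Suc k"] by (simp only: mult_pos_pos diff_gt_0_iff_gt)
  also have "\<dots> = inter_error k s"
    unfolding inter_error_eq by (subst (3) cf_error_quot) (simp add: algebra_simps)
  finally show ?thesis .
qed

lemma inter_error_Suc: "inter_error k (s + 1) < inter_error k s"
  using cf_error_sign[of "Suc k"] unfolding inter_error_eq by (simp add: algebra_simps)

text \<open>Adding multiples of the convergent at \<open>k + 1\<close> does not change the
  determinant in \<open>cf_det\<close>.\<close>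

lemma inter_det: "inter_den k s * num (k + 1) - inter_num k s * den (k + 1) = (-1) ^ Suc k"
  using cf_det[of \<alpha> k] by (simp add: inter_den_def inter_num_def algebra_simps)

lemma inter_den_Suc: "inter_den k (s + 1) = inter_den k s + den (k + 1)"
  by (simp add: inter_den_def algebra_simps)

text \<open>The end of one block is the start of the next block of the same parity, so the blocks
  join without a gap.\<close>

lemma inter_den_coeff: "inter_den k (coeff (k + 1)) = inter_den (k + 2) 0"
  by (simp add: inter_den_def)

lemma inter_den_nonneg: "0 \<le> s \<Longrightarrow> 0 \<le> inter_den k s"
  using den_nonneg by (simp add: inter_den_def)

lemma inter_den_eq_0_iff:
  assumes "0 \<le> s"
  shows "inter_den k s = 0 \<longleftrightarrow> k = 0 \<and> s = 0"
proof
  assume 0: "inter_den k s = 0"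
  have "0 \<le> s * den (k + 1)"
    using assms den_nonneg by simp
  hence d: "den k = 0" "s * den (k + 1) = 0"
    using 0 den_nonneg[of k] unfolding inter_den_def by linarith+
  show "k = 0 \<and> s = 0"
    using d den_Suc_pos[of "k - 1"] den_Suc_pos[of k] by (cases k) auto
qed (simp add: inter_den_def)

text \<open>The parity of \<open>p\<close> selects the side: odd for \<alpha>, even for
  \<open>- \<alpha>\<close>. Only indices \<open>k\<close> of that parity approximate from this
  side.\<close>

lemma inter_error_mult:
  assumes "even k = even p"
  shows "inter_error k s = of_int (inter_den k s) * ((-1) ^ Suc p * \<alpha>)
           - of_int ((-1) ^ Suc p * inter_num k s)"
  using assms unfolding inter_error_def by (cases "even p") (auto simp: algebra_simps)

text \<open>The intermediate fraction and the convergent at \<open>k + 1\<close> form the basis in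
  \<open>frac_lower_bound_unimodular\<close>; their denominators add up to
  \<open>inter_den k (s + 1)\<close>.\<close>

lemma inter_error_le_frac:
  assumes k: "even k = even p" and s: "0 \<le> s" "s < coeff (k + 1)"
    and r: "0 < r" "int r < inter_den k (s + 1)"
  shows "inter_error k s \<le> frac (real r * ((-1) ^ Suc p * \<alpha>))"
proof -
  let ?e = "(-1) ^ Suc p :: int"
  have e: "(-1) ^ Suc k = ?e" "(-1) ^ Suc k = (-1 :: real) ^ Suc p" "?e = 1 \<or> ?e = -1"
    using k by (cases "even p"; simp)+
  have "of_int (inter_den k s) * ((-1) ^ Suc p * \<alpha>) - of_int (?e * inter_num k s)
      \<le> frac (of_int (int r) * ((-1) ^ Suc p * \<alpha>))"
  proof (rule frac_lower_bound_unimodular[where Q = "den (k + 1)" and P = "?e * num (k + 1)"])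
    have "inter_den k s * (?e * num (k + 1)) - ?e * inter_num k s * den (k + 1)
        = (inter_den k s * num (k + 1) - inter_num k s * den (k + 1)) * ?e"
      by (simp add: algebra_simps del: power_Suc)
    also have "\<dots> = ?e * ?e" unfolding inter_det e(1) ..
    finally have "inter_den k s * (?e * num (k + 1)) - ?e * inter_num k s * den (k + 1) = ?e * ?e" .
    thus "\<bar>inter_den k s * (?e * num (k + 1)) - ?e * inter_num k s * den (k + 1)\<bar> = 1"
      using e(3) by auto
    show "0 \<le> inter_den k s" using s(1) by (rule inter_den_nonneg)
    show "0 < den (k + 1)" using den_Suc_pos[of k] by simp
    show "0 < of_int (inter_den k s) * ((-1) ^ Suc p * \<alpha>) - of_int (?e * inter_num k s)"
      using inter_error_pos[of s k] s(2) inter_error_mult[OF k, of s] by simp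
    show "of_int (den (k + 1)) * ((-1) ^ Suc p * \<alpha>) - of_int (?e * num (k + 1)) < 0"
      using cf_error_sign[of "Suc k"] e(2) k
      by (cases "even p") (auto simp: cf_error_def algebra_simps)
    show "int r < inter_den k s + den (k + 1)" using r(2) by (simp add: inter_den_Suc)
    show "0 < int r" using r(1) by simp
    have "of_int ((-1) ^ Suc p * int r) * \<alpha> \<notin> \<int>"
      using r(1) by (intro mult_notin_Ints) simp
    thus "of_int (int r) * ((-1) ^ Suc p * \<alpha>) \<notin> \<int>"
      by (simp add: mult_ac)
  qed
  thus ?thesis
    using inter_error_mult[OF k, of s] by simp
qed

lemma frac_le_inter_error:
  assumes "even k = even p" "s \<le> coeff (k + 1)" "int r = inter_den k s"
  shows "frac (real r * ((-1) ^ Suc p * \<alpha>)) \<le> inter_error k s"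
proof -
  have "frac (of_int (inter_den k s) * ((-1) ^ Suc p * \<alpha>)) \<le> inter_error k s"
    using inter_error_pos[OF assms(2)] unfolding inter_error_mult[OF assms(1)]
    by (intro frac_le_diff_int) simp
  thus ?thesis
    by (simp flip: assms(3))
qed

lemma inter_den_Suc_record:
  assumes k: "even k = even p" and s: "0 \<le> s" "s < coeff (k + 1)" and r: "int r = inter_den k (s + 1)"
  shows "fractional_record ((-1) ^ Suc p * \<alpha>) r"
  unfolding fractional_record_def
proof (intro allI impI)
  fix i assume i: "1 \<le> i \<and> i < r"
  have "frac (real r * ((-1) ^ Suc p * \<alpha>)) \<le> inter_error k (s + 1)"
    using s by (intro frac_le_inter_error[OF k _ r]) simp
  also have "\<dots> < inter_error k s" by (rule inter_error_Suc)
  also have "\<dots> \<le> frac (real i * ((-1) ^ Suc p * \<alpha>))"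
    using i r by (intro inter_error_le_frac[OF k s]) auto
  finally show "frac (real r * ((-1) ^ Suc p * \<alpha>)) < frac (real i * ((-1) ^ Suc p * \<alpha>))" .
qed

text \<open>The denominators \<open>den (p + 2 * j)\<close> of one parity grow without bound and cut
  the positive integers into blocks. Within a block, \<open>s\<close> is the quotient on division by
  \<open>den (k + 1)\<close>.\<close>

lemma between_inter_dens:
  fixes p r :: nat
  assumes "1 \<le> r" and "p \<le> 1"
  obtains k s where "even k = even p" "0 \<le> s" "s < coeff (k + 1)"
    "inter_den k s \<le> int r" "int r < inter_den k (s + 1)"
proof -
  have grow: "int j \<le> den (p + 2 * j)" for j :: nat
  proof (induction j)
    case 0
    show ?case using den_nonneg[of p] by simp
  next
    case (Suc j)
    thus ?case using den_Suc_Suc_gt[of "p + 2 * j"] by simp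
  qed
  define j where "j = (LEAST j. int r < den (p + 2 * j))"
  have ex: "int r < den (p + 2 * Suc r)"
    using grow[of "Suc r"] by linarith
  have j: "int r < den (p + 2 * j)"
    unfolding j_def by (rule LeastI) (rule ex)
  \<comment> \<open>The blocks start low enough, because \<open>den 0 = 0\<close> and
    \<open>den 1 = 1\<close>.\<close>
  have "j \<noteq> 0"
  proof
    assume "j = 0"
    hence "int r < den p" using j by simp
    moreover have "den p \<le> 1" using assms(2) by (cases p) auto
    ultimately show False using assms(1) by simp
  qed
  then obtain i where i: "j = Suc i" by (cases j) auto
  define k where "k = p + 2 * i"
  have ki: "den k \<le> int r"
    using not_less_Least[of i "\<lambda>j. int r < den (p + 2 * j)"] i
    unfolding j_def k_def by (simp add: not_less)
  have kj: "int r < coeff (k + 1) * den (k + 1) + den k"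
    using j i by (simp add: k_def)
  have pos: "den (k + 1) > 0" using den_Suc_pos[of k] by simp
  define s where "s = (int r - den k) div den (k + 1)"
  show thesis
  proof (rule that[of k s])
    show "even k = even p" by (simp add: k_def)
    show "0 \<le> s" using ki pos unfolding s_def by (simp add: pos_imp_zdiv_nonneg_iff)
    have "s * den (k + 1) + (int r - den k) mod den (k + 1) = int r - den k"
      unfolding s_def by (rule div_mult_mod_eq)
    moreover have "0 \<le> (int r - den k) mod den (k + 1)"
        "(int r - den k) mod den (k + 1) < den (k + 1)"
      using pos by simp_all
    ultimately show "inter_den k s \<le> int r" "int r < inter_den k (s + 1)"
      unfolding inter_den_def by (simp_all only: distrib_right mult_1)
    have "s * den (k + 1) < coeff (k + 1) * den (k + 1)"
      using \<open>inter_den k s \<le> int r\<close> kj unfolding inter_den_def by linarith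
    thus "s < coeff (k + 1)" using pos by (simp add: mult_less_cancel_right_pos)
  qed
qed

theorem fractional_record_iff_inter_den:
  assumes r: "1 \<le> r" and p: "p \<le> 1"
  shows "fractional_record ((-1) ^ Suc p * \<alpha>) r \<longleftrightarrow>
    (\<exists>k s. even k = even p \<and> 0 \<le> s \<and> s < coeff (k + 1) \<and> int r = inter_den k s)"
proof
  assume rec: "fractional_record ((-1) ^ Suc p * \<alpha>) r"
  obtain k s where ks: "even k = even p" "0 \<le> s" "s < coeff (k + 1)"
      "inter_den k s \<le> int r" "int r < inter_den k (s + 1)"
    using between_inter_dens[OF r p] by blast
  \<comment> \<open>Otherwise the largest intermediate denominator below \<open>r\<close> would be
    an earlier index whose fractional part is at most that of \<open>r\<close>.\<close>
  have "inter_den k s = int r"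
  proof (rule ccontr)
    assume ne: "inter_den k s \<noteq> int r"
    define i where "i = nat (inter_den k s)"
    have i: "int i = inter_den k s"
      using inter_den_nonneg[OF ks(2)] by (simp add: i_def)
    \<comment> \<open>The record condition says nothing about index 0, but that index would give
      \<open>int r < inter_den 0 1 = 1\<close>.\<close>
    have "i \<noteq> 0"
    proof
      assume "i = 0"
      hence "k = 0" "s = 0" using i inter_den_eq_0_iff[OF ks(2)] by simp_all
      thus False using ks(5) r by (simp add: inter_den_def)
    qed
    hence "frac (real r * ((-1) ^ Suc p * \<alpha>)) < frac (real i * ((-1) ^ Suc p * \<alpha>))"
      using rec i ks(4) ne unfolding fractional_record_def by auto
    also have "\<dots> \<le> inter_error k s"
      using ks(3) by (intro frac_le_inter_error[OF ks(1) _ i]) simp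
    also have "\<dots> \<le> frac (real r * ((-1) ^ Suc p * \<alpha>))"
      using r by (intro inter_error_le_frac[OF ks(1-3) _ ks(5)]) simp
    finally show False by simp
  qed
  thus "\<exists>k s. even k = even p \<and> 0 \<le> s \<and> s < coeff (k + 1) \<and> int r = inter_den k s"
    using ks by metis
next
  assume "\<exists>k s. even k = even p \<and> 0 \<le> s \<and> s < coeff (k + 1) \<and> int r = inter_den k s"
  then obtain k s where ks: "even k = even p" "0 \<le> s" "s < coeff (k + 1)" "int r = inter_den k s"
    by blast
  \<comment> \<open>A value \<open>s \<ge> 1\<close> is reached by a step inside its block. For
    \<open>s = 0\<close> the denominator is 0 at \<open>k = 0\<close>, it is 1 at
    \<open>k = 1\<close>, and beyond that it is the end of the block at
    \<open>k - 2\<close>.\<close>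
  show "fractional_record ((-1) ^ Suc p * \<alpha>) r"
  proof (cases "s = 0")
    case False
    thus ?thesis using ks by (intro inter_den_Suc_record[of k p "s - 1"]) auto
  next
    case s0: True
    consider "k = 0" | "k = 1" | l where "k = l + 2"
      by (metis One_nat_def add_2_eq_Suc' not0_implies_Suc)
    thus ?thesis
    proof cases
      case 1
      thus ?thesis using ks(4) s0 r by (simp add: inter_den_def)
    next
      case 2
      hence "r = 1" using ks(4) s0 by (simp add: inter_den_def)
      thus ?thesis by (simp add: fractional_record_def)
    next
      case 3
      have "int r = inter_den l (coeff (l + 1) - 1 + 1)"
        using ks(4) s0 3 inter_den_coeff[of l] by simp
      thus ?thesis
        using ks(1) 3 coeff_Suc_pos[of l] by (intro inter_den_Suc_record[of l p "coeff (l + 1) - 1"]) auto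
    qed
  qed
qed

section \<open>Denominators in lowest terms\<close>

lemma denominator_Fract_inter:
  assumes "0 < inter_den k s"
  shows "denominator (Fract (inter_num k s) (inter_den k s)) = inter_den k s"
proof -
  \<comment> \<open>A common divisor divides the determinant, which is a unit.\<close>
  have "gcd (inter_num k s) (inter_den k s) dvd
      inter_den k s * num (k + 1) - inter_num k s * den (k + 1)"
    by (intro dvd_diff dvd_mult2 gcd_dvd1 gcd_dvd2)
  hence "gcd (inter_num k s) (inter_den k s) dvd (-1) ^ Suc k"
    by (simp only: inter_det)
  hence "is_unit (gcd (inter_num k s) (inter_den k s))"
    by (rule dvd_unit_imp_unit) simp
  hence "coprime (inter_num k s) (inter_den k s)"
    by (simp add: coprime_iff_gcd_eq_1)
  thus ?thesis
    using assms by (simp add: denominator_def quotient_of_Fract Rat.normalize_def)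
qed

text \<open>Convergents are the fractions with \<open>s = 0\<close> and \<open>k \<ge> 1\<close>,
  semiconvergents those with \<open>s \<ge> 1\<close>. Only the formal fraction 1/0 at
  \<open>(0, 0)\<close> drops out.\<close>

lemma denominator_convergents_semiconvergents:
  "denominator ` (convergents \<alpha> \<union> semiconvergents \<alpha>) =
     {inter_den k s | k s. 0 \<le> s \<and> s < coeff (k + 1) \<and> (k, s) \<noteq> (0, 0)}"
proof -
  have conv: "convergents \<alpha> = {Fract (inter_num (k + 1) 0) (inter_den (k + 1) 0) | k. True}"
    by (simp add: convergents_def inter_num_def inter_den_def)
  have semi: "semiconvergents \<alpha> =
      {Fract (inter_num k s) (inter_den k s) | k s. 1 \<le> s \<and> s < coeff (k + 1)}"
    by (simp add: semiconvergents_def inter_num_def inter_den_def)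
  have den: "denominator (Fract (inter_num k s) (inter_den k s)) = inter_den k s"
    if "0 \<le> s" "(k, s) \<noteq> (0, 0)" for k s
    using that inter_den_nonneg[of s k] inter_den_eq_0_iff[of s k]
    by (intro denominator_Fract_inter) auto
  show ?thesis
  proof (intro equalityI subsetI)
    fix y assume "y \<in> denominator ` (convergents \<alpha> \<union> semiconvergents \<alpha>)"
    then consider k where "y = denominator (Fract (inter_num (k + 1) 0) (inter_den (k + 1) 0))"
      | k s where "1 \<le> s" "s < coeff (k + 1)" "y = denominator (Fract (inter_num k s) (inter_den k s))"
      unfolding conv semi by blast
    thus "y \<in> {inter_den k s | k s. 0 \<le> s \<and> s < coeff (k + 1) \<and> (k, s) \<noteq> (0, 0)}"
    proof cases
      case 1
      moreover have "0 < coeff (k + 1 + 1)" using coeff_Suc_pos[of "k + 1"] by simp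
      ultimately show ?thesis using den[of 0 "k + 1"] by force
    next
      case 2
      thus ?thesis using den[of s k] by force
    qed
  next
    fix y assume "y \<in> {inter_den k s | k s. 0 \<le> s \<and> s < coeff (k + 1) \<and> (k, s) \<noteq> (0, 0)}"
    then obtain k s where ks: "y = inter_den k s" "0 \<le> s" "s < coeff (k + 1)" "(k, s) \<noteq> (0, 0)"
      by blast
    have y: "y = denominator (Fract (inter_num k s) (inter_den k s))"
      using den ks by simp
    have "Fract (inter_num k s) (inter_den k s) \<in> convergents \<alpha> \<union> semiconvergents \<alpha>"
    proof (cases "s = 0")
      case True
      then obtain l where "k = l + 1" using ks(4) by (cases k) auto
      thus ?thesis unfolding conv True by blast
    next
      case False
      hence "1 \<le> s" using ks(2) by simp
      thus ?thesis unfolding semi using ks(3) by blast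
    qed
    thus "y \<in> denominator ` (convergents \<alpha> \<union> semiconvergents \<alpha>)"
      using y by blast
  qed
qed

end

subsection \<open>Counting rotations\<close>

definition two_letter_words :: "nat \<Rightarrow> nat \<Rightarrow> bool list set" where
  "two_letter_words n r = {w. length w = n \<and> count_list w True = r}"

lemma finite_two_letter_words [simp]: "finite (two_letter_words n r)"
  using finite_lists_length_eq[of "UNIV :: bool set" n]
  by (rule finite_subset[rotated]) (auto simp: two_letter_words_def)

lemma card_two_letter_words: "card (two_letter_words n r) = n choose r"
proof (induction n arbitrary: r)
  case 0
  have "two_letter_words 0 r = (if r = 0 then {[]} else {})"
    by (auto simp: two_letter_words_def)
  thus ?case by simp
next
  case (Suc n)
  show ?case
  proof (cases r)
    case 0
    have "two_letter_words (Suc n) 0 = (#) False ` two_letter_words n 0"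
      by (auto simp: two_letter_words_def length_Suc_conv image_iff split: if_splits)
    thus ?thesis using Suc[of 0] 0 by (simp add: card_image)
  next
    case (Suc k)
    have "two_letter_words (Suc n) (Suc k) =
        (#) False ` two_letter_words n (Suc k) \<union> (#) True ` two_letter_words n k"
      by (auto simp: two_letter_words_def length_Suc_conv image_iff split: if_splits)
    moreover have "(#) False ` two_letter_words n (Suc k) \<inter> (#) True ` two_letter_words n k = {}"
      by auto
    ultimately show ?thesis
      using Suc Suc.IH by (simp add: card_Un_disjoint card_image)
  qed
qed

lemma count_list_rotate [simp]: "count_list (rotate j w) x = count_list w x"
proof (induction j)
  case (Suc j)
  have "count_list (rotate1 v) x = count_list v x" for v
    by (cases v) auto
  thus ?case using Suc by simp
qed simp

text \<open>Rotation is injective and preserves length and letter count, so it permutes this finite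
  set.\<close>

lemma card_rotate_two_letter_words:
  "card {w \<in> two_letter_words n r. P (rotate j w)} = card {w \<in> two_letter_words n r. P w}"
proof -
  have inj: "inj (rotate j :: bool list \<Rightarrow> bool list)"
    unfolding rotate_def by (rule inj_fn[OF inj_rotate1])
  have "rotate j ` two_letter_words n r = two_letter_words n r"
    using inj by (intro endo_inj_surj) (auto simp: two_letter_words_def intro: inj_on_subset
      finite_two_letter_words[unfolded two_letter_words_def])
  hence "rotate j ` {w \<in> two_letter_words n r. P (rotate j w)} = {w \<in> two_letter_words n r. P w}"
    by auto
  thus ?thesis
    by (metis card_image inj inj_on_subset subset_UNIV)
qed

text \<open>Positions are counted, not distinct rotated words: a periodic word counts with
  multiplicity, which keeps the double count exact.\<close>

definition rotation_count :: "(bool list \<Rightarrow> bool) \<Rightarrow> bool list \<Rightarrow> nat" where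
  "rotation_count P w = card {j. j < length w \<and> P (rotate j w)}"

text \<open>Exchange the sums over words and positions; each of the \<open>n\<close> positions
  contributes the same number.\<close>

lemma sum_rotation_count:
  "(\<Sum>w\<in>two_letter_words n r. rotation_count P w) = n * card {w \<in> two_letter_words n r. P w}"
proof -
  have "rotation_count P w = (\<Sum>j<n. if P (rotate j w) then 1 else 0)"
    if "w \<in> two_letter_words n r" for w
  proof -
    have "{..<n} \<inter> {j. P (rotate j w)} = {j. j < length w \<and> P (rotate j w)}"
      using that by (auto simp: two_letter_words_def)
    thus ?thesis by (simp add: rotation_count_def sum.If_cases)
  qed
  hence "(\<Sum>w\<in>two_letter_words n r. rotation_count P w) =
      (\<Sum>w\<in>two_letter_words n r. \<Sum>j<n. if P (rotate j w) then 1 else 0)"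
    by simp
  also have "\<dots> = (\<Sum>j<n. \<Sum>w\<in>two_letter_words n r. if P (rotate j w) then 1 else 0)"
    by (rule sum.swap)
  also have "\<dots> = (\<Sum>j<n. card {w \<in> two_letter_words n r. P (rotate j w)})"
    by (simp add: sum.If_cases Int_def)
  also have "\<dots> = n * card {w \<in> two_letter_words n r. P w}"
    by (simp add: card_rotate_two_letter_words)
  finally show ?thesis .
qed

text \<open>The alternative \<open>1 \<le> f x\<close> serves the lower bound and
  \<open>f x \<le> 1\<close> the upper one; equal sums of termwise comparable functions force
  termwise equality.\<close>

lemma sum_eq_card_iff:
  fixes f :: "'a \<Rightarrow> nat"
  assumes "finite A" and "(\<forall>x\<in>A. 1 \<le> f x) \<or> (\<forall>x\<in>A. f x \<le> 1)"
  shows "sum f A = card A \<longleftrightarrow> (\<forall>x\<in>A. f x = 1)"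
proof
  assume "sum f A = card A"
  hence eq: "(\<Sum>x\<in>A. f x) = (\<Sum>x\<in>A. 1)" by simp
  show "\<forall>x\<in>A. f x = 1"
    using assms(2)
  proof
    assume "\<forall>x\<in>A. 1 \<le> f x"
    thus ?thesis using sum_mono_inv[OF eq[symmetric] _ _ assms(1)] by metis
  next
    assume "\<forall>x\<in>A. f x \<le> 1"
    thus ?thesis using sum_mono_inv[OF eq _ _ assms(1)] by metis
  qed
qed simp

lemma rotation_count_pos_iff:
  "1 \<le> rotation_count P w \<longleftrightarrow> (\<exists>u v. w = u @ v \<and> v \<noteq> [] \<and> P (v @ u))"
proof -
  have "1 \<le> rotation_count P w \<longleftrightarrow> (\<exists>j < length w. P (rotate j w))"
    by (auto simp: rotation_count_def Suc_le_eq card_gt_0_iff)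
  also have "\<dots> \<longleftrightarrow> (\<exists>u v. w = u @ v \<and> v \<noteq> [] \<and> P (v @ u))"
  proof
    assume "\<exists>j < length w. P (rotate j w)"
    then obtain j where j: "j < length w" "P (rotate j w)" by blast
    hence "w = take j w @ drop j w" "drop j w \<noteq> []" "P (drop j w @ take j w)"
      by (simp_all add: rotate_drop_take)
    thus "\<exists>u v. w = u @ v \<and> v \<noteq> [] \<and> P (v @ u)" by blast
  next
    assume "\<exists>u v. w = u @ v \<and> v \<noteq> [] \<and> P (v @ u)"
    then obtain u v where "w = u @ v" "v \<noteq> []" "P (v @ u)" by blast
    hence "length u < length w" "P (rotate (length u) w)"
      by (simp_all add: rotate_append)
    thus "\<exists>j < length w. P (rotate j w)" by blast
  qed
  finally show ?thesis .
qed

text \<open>Two good positions cut the word into three pieces. The first may be empty; the others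
  are not, as the positions differ and lie before the end.\<close>

lemma rotation_count_le_1_iff:
  "rotation_count P w \<le> 1 \<longleftrightarrow>
     \<not> (\<exists>a b c. w = a @ b @ c \<and> b \<noteq> [] \<and> c \<noteq> [] \<and> P (b @ c @ a) \<and> P (c @ a @ b))"
proof -
  define A where "A = {j. j < length w \<and> P (rotate j w)}"
  have "finite A" by (simp add: A_def)
  hence "rotation_count P w \<le> 1 \<longleftrightarrow> (\<forall>i\<in>A. \<forall>j\<in>A. i = j)"
    by (simp add: rotation_count_def card_le_Suc0_iff_eq flip: A_def)
  also have "\<dots> \<longleftrightarrow> \<not> (\<exists>i j. i < j \<and> i \<in> A \<and> j \<in> A)"
    by (metis less_irrefl linorder_neqE_nat)
  also have "(\<exists>i j. i < j \<and> i \<in> A \<and> j \<in> A) \<longleftrightarrow>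
      (\<exists>i j. i < j \<and> j < length w \<and> P (rotate i w) \<and> P (rotate j w))"
    unfolding A_def using less_trans by blast
  also have "(\<exists>i j. i < j \<and> j < length w \<and> P (rotate i w) \<and> P (rotate j w)) \<longleftrightarrow>
      (\<exists>a b c. w = a @ b @ c \<and> b \<noteq> [] \<and> c \<noteq> [] \<and> P (b @ c @ a) \<and> P (c @ a @ b))"
  proof
    assume "\<exists>i j. i < j \<and> j < length w \<and> P (rotate i w) \<and> P (rotate j w)"
    then obtain i j where ij: "i < j" "j < length w" "P (rotate i w)" "P (rotate j w)" by blast
    define a b c where "a = take i w" and "b = drop i (take j w)" and "c = drop j w"
    have tj: "take j w = a @ b"
      using append_take_drop_id[of i "take j w"] ij(1) by (simp add: a_def b_def min_def)
    hence w: "w = a @ b @ c"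
      using append_take_drop_id[of j w] by (simp add: c_def)
    have ne: "b \<noteq> []" "c \<noteq> []" using ij by (simp_all add: b_def c_def)
    have la: "length a = i" "length (a @ b) = j"
      using ij by (simp_all add: a_def b_def)
    have "rotate i w = b @ c @ a"
      using rotate_append[of a "b @ c"] w la by simp
    moreover have "rotate j w = c @ a @ b"
      using rotate_append[of "a @ b" c] w la by simp
    ultimately show "\<exists>a b c. w = a @ b @ c \<and> b \<noteq> [] \<and> c \<noteq> [] \<and> P (b @ c @ a) \<and> P (c @ a @ b)"
      using w ne ij by metis
  next
    assume "\<exists>a b c. w = a @ b @ c \<and> b \<noteq> [] \<and> c \<noteq> [] \<and> P (b @ c @ a) \<and> P (c @ a @ b)"
    then obtain a b c where *: "w = a @ b @ c" "b \<noteq> []" "c \<noteq> []" "P (b @ c @ a)" "P (c @ a @ b)"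
      by blast
    have "rotate (length a) w = b @ c @ a" "rotate (length (a @ b)) w = c @ a @ b"
      using rotate_append[of a "b @ c"] rotate_append[of "a @ b" c] *(1) by simp_all
    hence "length a < length (a @ b) \<and> length (a @ b) < length w \<and>
        P (rotate (length a) w) \<and> P (rotate (length (a @ b)) w)"
      using * by simp
    thus "\<exists>i j. i < j \<and> j < length w \<and> P (rotate i w) \<and> P (rotate j w)" by blast
  qed
  finally show ?thesis .
qed

section \<open>Paths with steps \<alpha> - 1 and -1\<close>

locale irrational_slope = irrational +
  assumes gt_1: "1 < \<alpha>"
begin

text \<open>
  With \<open>True\<close> standing for the letter \<open>q / 2\<close>, \<open>False\<close> for \<open>1 / 2\<close>, and \<open>\<alpha> = log 2 q\<close>, the height
  is the binary logarithm of the product of the letters.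
\<close>
definition height :: "bool list \<Rightarrow> real" where
  "height w = real (count_list w True) * \<alpha> - real (length w)"

definition steps_below :: "nat \<Rightarrow> nat" where
  "steps_below r = nat \<lfloor>real r * \<alpha>\<rfloor>"

definition stays_positive :: "bool list \<Rightarrow> bool" where
  "stays_positive w \<longleftrightarrow> (\<forall>u v. w = u @ v \<and> u \<noteq> [] \<longrightarrow> 0 < height u)"

text \<open>Logarithmic form of admissibility; \<open>v \<noteq> []\<close> exempts the endpoint,
  where the path first drops below 0.\<close>

definition first_passage :: "bool list \<Rightarrow> bool" where
  "first_passage w \<longleftrightarrow>
     (\<forall>u v. w = u @ v \<and> u \<noteq> [] \<and> v \<noteq> [] \<longrightarrow> 0 < height u) \<and> height w < 0"

lemma height_Nil [simp]: "height [] = 0"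
  and height_append [simp]: "height (u @ v) = height u + height v"
  by (simp_all add: height_def algebra_simps)

lemma frac_mult_pos:
  assumes "1 \<le> i"
  shows "0 < frac (real i * \<alpha>)" "frac (real i * - \<alpha>) = 1 - frac (real i * \<alpha>)"
proof -
  have "real i * \<alpha> \<notin> \<int>"
    using mult_notin_Ints[of "int i"] assms by simp
  thus "0 < frac (real i * \<alpha>)" "frac (real i * - \<alpha>) = 1 - frac (real i * \<alpha>)"
    by (simp_all add: frac_neg)
qed

text \<open>A nonempty word of height 0 would make \<alpha> rational. This turns weak minimality of
  a prefix into strict positivity.\<close>

lemma height_eq_0_iff: "height w = 0 \<longleftrightarrow> w = []"
proof
  assume 0: "height w = 0"
  hence "of_int (int (count_list w True)) * \<alpha> \<in> \<int>"
    by (simp add: height_def)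
  hence "count_list w True = 0"
    using mult_notin_Ints[of "int (count_list w True)"] by (cases "count_list w True = 0") auto
  thus "w = []" using 0 by (simp add: height_def)
qed simp

lemma steps_below_frac: "real (steps_below r) = real r * \<alpha> - frac (real r * \<alpha>)"
  using gt_1 by (simp add: steps_below_def frac_def)

lemma le_steps_below: "r \<le> steps_below r"
proof -
  have "real r \<le> real r * \<alpha>" using gt_1 by (simp add: mult_le_cancel_left1)
  thus ?thesis
    unfolding steps_below_def by (simp add: le_nat_floor)
qed

lemma height_two_letter_word:
  assumes "w \<in> two_letter_words (steps_below r) r"
  shows "height w = frac (real r * \<alpha>)"
  using assms steps_below_frac[of r] by (simp add: two_letter_words_def height_def)

text \<open>The height is an integer away from a multiple of \<alpha>, and the fractional part is
  the least nonnegative number of that kind.\<close>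

lemma frac_le_height:
  assumes "0 \<le> height w"
  shows "frac (real (count_list w True) * \<alpha>) \<le> height w"
  using frac_le_diff_int[of "real (count_list w True) * \<alpha>" "int (length w)"] assms
  by (simp add: height_def)

lemma frac_uminus_le_height:
  assumes "height w \<le> 0"
  shows "frac (real (count_list w True) * - \<alpha>) \<le> - height w"
  using frac_le_diff_int[of "real (count_list w True) * - \<alpha>" "- int (length w)"] assms
  by (simp add: height_def)

lemma count_pos_if_height_pos:
  assumes "0 < height w"
  shows "1 \<le> count_list w True"
  using assms by (cases "count_list w True") (auto simp: height_def)

subsection \<open>The lower bound\<close>

text \<open>Cut the word at a prefix of minimal height.\<close>
lemma ex_rotation_stays_positive:
  assumes "0 < height w"
  shows "\<exists>u v. w = u @ v \<and> v \<noteq> [] \<and> stays_positive (v @ u)"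
proof -
  define H where "H l = height (take l w)" for l
  obtain l where "is_arg_min H (\<lambda>l. l \<in> {..length w}) l"
    using ex_is_arg_min_if_finite[of "{..length w}" H] by auto
  hence l: "l \<le> length w" "\<And>l'. l' \<le> length w \<Longrightarrow> H l \<le> H l'"
    by (simp_all add: is_arg_min_linorder)
  define u v where "u = take l w" and "v = drop l w"
  have w: "w = u @ v" by (simp add: u_def v_def)
  have min: "height u \<le> height u'" if "w = u' @ v'" for u' v'
    using l(2)[of "length u'"] that by (simp add: H_def u_def)
  \<comment> \<open>The empty prefix competes for the minimum, so the cut is not at the end of
    \<open>w\<close>, where the height is positive.\<close>
  have hu: "height u \<le> 0" using min[of "[]" w] by simp
  have "v \<noteq> []" using hu assms w by auto
  moreover have "stays_positive (v @ u)"
    unfolding stays_positive_def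
  proof (intro allI impI)
    \<comment> \<open>A prefix ending in \<open>v\<close> rises from the minimum. One ending in
      \<open>u\<close>, say at \<open>u'\<close>, has height
      \<open>height w + (height u' - height u)\<close>, at least \<open>height w\<close>.\<close>
    fix p s assume ps: "v @ u = p @ s \<and> p \<noteq> []"
    consider x where "v = p @ x" | u' where "p = v @ u'" "u = u' @ s"
      using ps by (auto simp: append_eq_append_conv2)
    thus "0 < height p"
    proof cases
      case 1
      hence "height u \<le> height (u @ p)" using min[of "u @ p" x] w by simp
      thus ?thesis using height_eq_0_iff[of p] ps by simp
    next
      case 2
      have "height u \<le> height u'" using min[of u' "s @ v"] w 2 by simp
      thus ?thesis using assms w 2 by simp
    qed
  qed
  ultimately show ?thesis using w by blast
qed

text \<open>Any word of this shape has height \<open>frac (real r * \<alpha>)\<close>, so some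
  rotation of it works.\<close>

lemma ex_stays_positive: "\<exists>w \<in> two_letter_words (steps_below r) r. stays_positive w"
proof (cases "r = 0")
  case True
  thus ?thesis by (auto simp: two_letter_words_def steps_below_def stays_positive_def)
next
  case False
  have "card (two_letter_words (steps_below r) r) \<noteq> 0"
    using le_steps_below[of r] by (simp add: card_two_letter_words)
  then obtain w where w: "w \<in> two_letter_words (steps_below r) r"
    by (metis card.empty ex_in_conv)
  have "0 < height w"
    using height_two_letter_word[OF w] frac_mult_pos(1)[of r] False by simp
  then obtain u v where "w = u @ v" "stays_positive (v @ u)"
    using ex_rotation_stays_positive by blast
  thus ?thesis using w by (intro bexI[of _ "v @ u"]) (auto simp: two_letter_words_def)
qed

lemma stays_positive_append:
  assumes "stays_positive u" "stays_positive v"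
  shows "stays_positive (u @ v)"
  unfolding stays_positive_def
proof (intro allI impI)
  fix p s assume ps: "u @ v = p @ s \<and> p \<noteq> []"
  consider x where "u = p @ x" | x where "p = u @ x" "v = x @ s" "x \<noteq> []"
    using ps by (auto simp: append_eq_append_conv2) (metis append_Nil2)+
  thus "0 < height p"
  proof cases
    case 1
    thus ?thesis using assms(1) ps by (auto simp: stays_positive_def)
  next
    case 2
    have "0 < height x" using 2 assms(2) by (auto simp: stays_positive_def)
    moreover have "0 \<le> height u"
      using assms(1) height_Nil by (cases "u = []") (auto simp: stays_positive_def intro: less_imp_le)
    ultimately show ?thesis using 2 by simp
  qed
qed

text \<open>By \<open>first_passage_set\<close> this also counts first-passage words, so one number
  serves both bounds.\<close>

definition num_positive :: "nat \<Rightarrow> nat" where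
  "num_positive r = card {w \<in> two_letter_words (steps_below r) r. stays_positive w}"

theorem num_positive_lower_eq_iff:
  assumes r: "1 \<le> r"
  shows "steps_below r * num_positive r = (steps_below r choose r) \<longleftrightarrow> fractional_record \<alpha> r"
proof -
  let ?W = "two_letter_words (steps_below r) r"
  have hW: "height w = frac (real r * \<alpha>)" "0 < height w" if "w \<in> ?W" for w
    using height_two_letter_word[OF that] frac_mult_pos(1)[OF r] by simp_all
  have ge: "1 \<le> rotation_count stays_positive w" if "w \<in> ?W" for w
    unfolding rotation_count_pos_iff using ex_rotation_stays_positive[OF hW(2)[OF that]] .
  have "steps_below r * num_positive r = (steps_below r choose r) \<longleftrightarrow>
      (\<Sum>w\<in>?W. rotation_count stays_positive w) = card ?W"
    unfolding num_positive_def by (simp add: sum_rotation_count card_two_letter_words)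
  also have "\<dots> \<longleftrightarrow> (\<forall>w\<in>?W. rotation_count stays_positive w = 1)"
    using ge by (intro sum_eq_card_iff) auto
  also have "\<dots> \<longleftrightarrow> (\<forall>w\<in>?W. rotation_count stays_positive w \<le> 1)"
    using ge by (auto intro: le_antisym)
  also have "\<dots> \<longleftrightarrow> fractional_record \<alpha> r"
  proof
    assume le1: "\<forall>w\<in>?W. rotation_count stays_positive w \<le> 1"
    show "fractional_record \<alpha> r"
      unfolding fractional_record_def
    proof (intro allI impI, rule ccontr)
      fix i assume i: "1 \<le> i \<and> i < r" and "\<not> frac (real r * \<alpha>) < frac (real i * \<alpha>)"
      hence le: "frac (real i * \<alpha>) \<le> frac (real r * \<alpha>)" by simp
      \<comment> \<open>The subtraction involves no borrow, so the lengths for \<open>i\<close> and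
        \<open>r - i\<close> add up to the length for \<open>r\<close>.\<close>
      have "frac (real r * \<alpha> - real i * \<alpha>) = frac (real r * \<alpha>) - frac (real i * \<alpha>)"
        using le by (rule frac_diff_pos)
      hence "frac (real (r - i) * \<alpha>) = frac (real r * \<alpha>) - frac (real i * \<alpha>)"
        using i by (simp add: of_nat_diff left_diff_distrib)
      hence "real (steps_below i + steps_below (r - i)) = real (steps_below r)"
        using i by (simp add: steps_below_frac of_nat_diff algebra_simps)
      hence m: "steps_below i + steps_below (r - i) = steps_below r" by linarith
      obtain u v where u: "u \<in> two_letter_words (steps_below i) i" "stays_positive u"
        and v: "v \<in> two_letter_words (steps_below (r - i)) (r - i)" "stays_positive v"
        using ex_stays_positive by blast
      have "u @ v \<in> ?W"
        using u(1) v(1) i m by (simp add: two_letter_words_def)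
      moreover have "u \<noteq> []" "v \<noteq> []"
        using u(1) v(1) i by (auto simp: two_letter_words_def)
      \<comment> \<open>Both \<open>u @ v\<close> and \<open>v @ u\<close> stay positive: take
        \<open>a = []\<close>, \<open>b = u\<close>, \<open>c = v\<close>.\<close>
      hence "\<not> rotation_count stays_positive (u @ v) \<le> 1"
        unfolding rotation_count_le_1_iff
        using stays_positive_append[OF u(2) v(2)] stays_positive_append[OF v(2) u(2)]
        by (metis append_Nil append_Nil2)
      ultimately show False using le1 by blast
    qed
  next
    assume rec: "fractional_record \<alpha> r"
    show "\<forall>w\<in>?W. rotation_count stays_positive w \<le> 1"
      unfolding rotation_count_le_1_iff
    proof (intro ballI notI, elim exE conjE)
      fix w a b c
      assume w: "w \<in> ?W" "w = a @ b @ c" and ne: "b \<noteq> []" "c \<noteq> []"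
        and pos: "stays_positive (b @ c @ a)" "stays_positive (c @ a @ b)"
      \<comment> \<open>The two good rotations split \<open>w\<close> cyclically into
        \<open>b\<close> and \<open>c @ a\<close>, both of positive height, so \<open>b\<close> is
        lower than \<open>w\<close> and has between 1 and \<open>r - 1\<close> up-steps.\<close>
      have b: "0 < height b"
        using pos(1) ne by (auto simp: stays_positive_def)
      have "stays_positive ((c @ a) @ b)" using pos(2) by simp
      hence ca: "0 < height (c @ a)"
        using ne unfolding stays_positive_def by blast
      define i where "i = count_list b True"
      have "1 \<le> i" "i < r"
        using count_pos_if_height_pos[OF b] count_pos_if_height_pos[OF ca] w
        by (auto simp: i_def two_letter_words_def)
      hence "frac (real r * \<alpha>) < frac (real i * \<alpha>)"
        using rec by (simp add: fractional_record_def)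
      also have "\<dots> \<le> height b" using frac_le_height b by (simp add: i_def)
      also have "\<dots> < height w" using w(2) ca by simp
      finally show False using hW(1)[OF w(1)] by simp
    qed
  qed
  finally show ?thesis .
qed

subsection \<open>The upper bound\<close>

text \<open>Since \<alpha> > 1, an up-step cannot take a positive height below 0, so the last step
  is down. The height before it lies between 0 and 1, which determines the length.\<close>

lemma first_passage_iff:
  assumes "count_list w True = r" "1 \<le> r"
  shows "first_passage w \<longleftrightarrow>
    (\<exists>v \<in> two_letter_words (steps_below r) r. stays_positive v \<and> w = v @ [False])"
proof
  assume fp: "first_passage w"
  hence "w \<noteq> []" by (auto simp: first_passage_def)
  then obtain v x where w: "w = v @ [x]" by (cases w rule: rev_cases) auto
  have "v \<noteq> []"
  proof
    assume "v = []"
    hence "w = [True]" using w assms by (cases x) auto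
    thus False using fp gt_1 by (simp add: first_passage_def height_def)
  qed
  have pos: "stays_positive v"
    using fp w by (force simp: stays_positive_def first_passage_def)
  hence v: "0 < height v"
    using \<open>v \<noteq> []\<close> by (auto simp: stays_positive_def)
  have neg: "height v + height [x] < 0" using fp w by (simp add: first_passage_def)
  have "\<not> x"
    using v neg gt_1 by (cases x) (auto simp: height_def)
  hence x: "w = v @ [False]" "height [x] = -1" using w by (simp_all add: height_def)
  have c: "count_list v True = r" using x assms by simp
  have "real (length v) < real r * \<alpha>" "real r * \<alpha> < real (length v) + 1"
    using v neg[unfolded x(2)] c by (simp_all add: height_def)
  hence "\<lfloor>real r * \<alpha>\<rfloor> = int (length v)" by (intro floor_unique) auto
  hence "length v = steps_below r" by (simp add: steps_below_def)
  thus "\<exists>v \<in> two_letter_words (steps_below r) r. stays_positive v \<and> w = v @ [False]"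
    using pos x c by (auto simp: two_letter_words_def)
next
  assume "\<exists>v \<in> two_letter_words (steps_below r) r. stays_positive v \<and> w = v @ [False]"
  then obtain v where v: "v \<in> two_letter_words (steps_below r) r" "stays_positive v" "w = v @ [False]"
    by blast
  have "height w < 0"
    using height_two_letter_word[OF v(1)] frac_lt_1[of "real r * \<alpha>"] v(3) by (simp add: height_def)
  moreover have "0 < height u" if "w = u @ x" "u \<noteq> []" "x \<noteq> []" for u x
  proof -
    have "v = u @ butlast x"
      using that v(3) by (metis butlast_append butlast_snoc)
    thus ?thesis using v(2) that by (auto simp: stays_positive_def)
  qed
  ultimately show "first_passage w" by (auto simp: first_passage_def)
qed

text \<open>The length of a first-passage word is forced, which makes rotation counting applicable;
  deleting the last letter is a bijection onto the positive words.\<close>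

lemma first_passage_set:
  assumes "1 \<le> r"
  shows "{w. count_list w True = r \<and> first_passage w} =
      {w \<in> two_letter_words (Suc (steps_below r)) r. first_passage w}"
    and "card {w. count_list w True = r \<and> first_passage w} = num_positive r"
proof -
  have snoc: "v @ [False] \<in> two_letter_words (Suc (steps_below r)) r"
    if "v \<in> two_letter_words (steps_below r) r" for v
    using that by (simp add: two_letter_words_def)
  have iff: "count_list w True = r \<and> first_passage w \<longleftrightarrow>
      (\<exists>v \<in> two_letter_words (steps_below r) r. stays_positive v \<and> w = v @ [False])" for w
  proof (cases "count_list w True = r")
    case True
    thus ?thesis using first_passage_iff[OF True assms] by simp
  next
    case False
    hence "w \<notin> two_letter_words (Suc (steps_below r)) r"
      by (simp add: two_letter_words_def)
    thus ?thesis using False snoc by blast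
  qed
  have "w \<in> two_letter_words (Suc (steps_below r)) r"
    if "count_list w True = r \<and> first_passage w" for w
    using that snoc unfolding iff by blast
  moreover have "count_list w True = r" if "w \<in> two_letter_words (Suc (steps_below r)) r" for w
    using that by (simp add: two_letter_words_def)
  ultimately show "{w. count_list w True = r \<and> first_passage w} =
      {w \<in> two_letter_words (Suc (steps_below r)) r. first_passage w}"
    by blast
  have "{w. count_list w True = r \<and> first_passage w} =
      (\<lambda>v. v @ [False]) ` {w \<in> two_letter_words (steps_below r) r. stays_positive w}"
    unfolding iff by blast
  thus "card {w. count_list w True = r \<and> first_passage w} = num_positive r"
    by (simp add: num_positive_def card_image inj_on_def)
qed

lemma ex_first_passage:
  assumes "1 \<le> r"
  shows "\<exists>w \<in> two_letter_words (Suc (steps_below r)) r. first_passage w"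
proof -
  obtain v where "v \<in> two_letter_words (steps_below r) r" "stays_positive v"
    using ex_stays_positive by blast
  thus ?thesis
    using assms first_passage_iff[of "v @ [False]" r]
    by (intro bexI[of _ "v @ [False]"]) (auto simp: two_letter_words_def)
qed

text \<open>Wherever the cut falls, it splits \<open>u\<close> or \<open>v\<close> into a first
  piece of nonnegative height and a rest that begins the rotated word and so has positive height.
  That factor would then not end below 0.\<close>

lemma first_passage_append_no_rotation:
  assumes u: "first_passage u" and v: "first_passage v"
  shows "\<not> 1 \<le> rotation_count first_passage (u @ v)"
  unfolding rotation_count_pos_iff
proof (intro notI, elim exE conjE)
  fix a b assume ab: "u @ v = a @ b" "b \<noteq> []" and fp: "first_passage (b @ a)"
  have ne: "u \<noteq> []" "v \<noteq> []" using u v by (auto simp: first_passage_def)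
  have prefix_nonneg: "0 \<le> height x" if "first_passage w" "w = x @ y" "y \<noteq> []" for w x y
    using that by (cases "x = []") (auto simp: first_passage_def intro: less_imp_le)
  consider x where "a = u @ x" "v = x @ b" | y where "u = a @ y" "b = y @ v" "y \<noteq> []"
    using ab ne by (auto simp: append_eq_append_conv2) (metis append_Nil append_Nil2)+
  thus False
  proof cases
    case 1
    have "0 < height b"
      using fp 1 ab(2) ne by (auto simp: first_passage_def)
    moreover have "0 \<le> height x" using prefix_nonneg[OF v 1(2) ab(2)] .
    ultimately show False using v 1 by (simp add: first_passage_def)
  next
    case 2
    have "0 < height y"
      using fp 2 ne by (auto simp: first_passage_def)
    moreover have "0 \<le> height a" using prefix_nonneg[OF u 2(1) 2(3)] .
    ultimately show False using u 2 by (simp add: first_passage_def)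
  qed
qed

text \<open>With two good rotations, \<open>b\<close> and \<open>c @ a\<close> would both have
  positive height, but together they have the negative total height.\<close>

lemma rotation_count_first_passage_le_1: "rotation_count first_passage w \<le> 1"
  unfolding rotation_count_le_1_iff
proof (intro notI, elim exE conjE)
  fix a b c
  assume ne: "b \<noteq> []" "c \<noteq> []"
    and fp: "first_passage (b @ c @ a)" "first_passage (c @ a @ b)"
  have "0 < height b" using fp(1) ne by (auto simp: first_passage_def)
  moreover have "first_passage ((c @ a) @ b)" using fp(2) by simp
  hence "0 < height (c @ a)" using ne unfolding first_passage_def by blast
  ultimately show False using fp(1) by (simp add: first_passage_def)
qed

lemma ex_rotation_first_passage:
  assumes rec: "fractional_record (- \<alpha>) r" and r: "1 \<le> r"
    and w: "w \<in> two_letter_words (Suc (steps_below r)) r"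
  shows "\<exists>u v. w = u @ v \<and> v \<noteq> [] \<and> first_passage (v @ u)"
proof -
  have hw: "height w = - frac (real r * - \<alpha>)"
    using w steps_below_frac[of r] frac_mult_pos(2)[OF r]
    by (simp add: two_letter_words_def height_def)
  have neg: "height w < 0"
    using hw frac_mult_pos(2)[OF r] frac_lt_1[of "real r * \<alpha>"] by simp
  define H where "H l = height (take l w)" for l
  \<comment> \<open>The total height is negative, so the whole word beats the empty prefix; the
    minimum is taken over nonempty prefixes.\<close>
  have "{1..length w} \<noteq> {}" using w by (simp add: two_letter_words_def)
  then obtain l where "is_arg_min H (\<lambda>l. l \<in> {1..length w}) l"
    using ex_is_arg_min_if_finite[of "{1..length w}" H] by auto
  hence l: "1 \<le> l" "l \<le> length w" "\<And>l'. 1 \<le> l' \<Longrightarrow> l' \<le> length w \<Longrightarrow> H l \<le> H l'"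
    by (simp_all add: is_arg_min_linorder)
  define u v where "u = take l w" and "v = drop l w"
  have uv: "w = u @ v" by (simp add: u_def v_def)
  have "u \<noteq> []" using l by (auto simp: u_def)
  have min: "height u \<le> height u'" if "w = u' @ v'" "u' \<noteq> []" for u' v'
    using l(3)[of "length u'"] that by (simp add: H_def u_def Suc_le_eq)
  have "first_passage (v @ u)"
    unfolding first_passage_def
  proof (intro conjI allI impI)
    show "height (v @ u) < 0" using neg uv by simp
    fix p s assume ps: "v @ u = p @ s \<and> p \<noteq> [] \<and> s \<noteq> []"
    consider x where "v = p @ x" | u' where "p = v @ u'" "u = u' @ s" "u' \<noteq> []"
      using ps by (auto simp: append_eq_append_conv2) (metis append_Nil2)+
    thus "0 < height p"
    proof cases
      case 1
      hence "height u \<le> height (u @ p)" using min[of "u @ p" x] uv ps by simp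
      thus ?thesis using height_eq_0_iff[of p] ps by simp
    next
      case 2
      have "height u \<le> height u'" using min[of u' "s @ v"] uv 2 by simp
      hence s: "height s \<le> 0" using 2 by simp
      define i where "i = count_list s True"
      \<comment> \<open>This says that removing \<open>s\<close> from the end of
        \<open>v @ u\<close> leaves positive height. Without up-steps \<open>s\<close> has height at
        most -1; with all \<open>r\<close> of them and at most \<open>steps_below r\<close> letters
        its height would be positive; otherwise the record condition applies.\<close>
      have "frac (real r * - \<alpha>) < - height s"
      proof -
        have cw: "i \<le> r" using w uv 2 by (simp add: i_def two_letter_words_def)
        have lw: "length s \<le> steps_below r"
          using w uv 2 by (cases u') (auto simp: two_letter_words_def)
        consider "i = 0" | "i = r" | "1 \<le> i" "i < r" using cw by linarith
        thus ?thesis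
        proof cases
          case 1
          have "1 \<le> length s" using ps by (simp add: Suc_le_eq)
          hence "1 \<le> - height s" using 1 by (simp add: height_def i_def)
          thus ?thesis using frac_lt_1[of "real r * - \<alpha>"] by linarith
        next
          case 2
          have "real (length s) \<le> real r * \<alpha> - frac (real r * \<alpha>)"
            using lw by (simp flip: steps_below_frac)
          moreover have "height s = real r * \<alpha> - real (length s)"
            using 2 by (simp add: height_def i_def)
          ultimately have "0 < height s"
            using frac_mult_pos(1)[OF r] by linarith
          thus ?thesis using s by simp
        next
          case 3
          thus ?thesis
            using rec frac_uminus_le_height[OF s] unfolding fractional_record_def i_def by force
        qed
      qed
      thus ?thesis using hw uv 2 by simp
    qed
  qed
  \<comment> \<open>A minimum at the very end means rotation by 0, so the witness is then the split
    \<open>[] @ w\<close>.\<close>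
  moreover have "first_passage (w @ [])" if "v = []"
    using calculation uv that by simp
  ultimately show ?thesis
    using uv \<open>u \<noteq> []\<close> by (cases "v = []") (auto intro: exI[of _ "[]"])
qed

theorem num_positive_upper_eq_iff:
  assumes r: "1 \<le> r"
  shows "Suc (steps_below r) * num_positive r = (Suc (steps_below r) choose r) \<longleftrightarrow>
    fractional_record (- \<alpha>) r"
proof -
  let ?W = "two_letter_words (Suc (steps_below r)) r"
  have "Suc (steps_below r) * num_positive r = (Suc (steps_below r) choose r) \<longleftrightarrow>
      (\<Sum>w\<in>?W. rotation_count first_passage w) = card ?W"
    unfolding sum_rotation_count first_passage_set(2)[OF r, symmetric] first_passage_set(1)[OF r]
    by (simp add: card_two_letter_words)
  also have "\<dots> \<longleftrightarrow> (\<forall>w\<in>?W. rotation_count first_passage w = 1)"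
    using rotation_count_first_passage_le_1 by (intro sum_eq_card_iff) auto
  also have "\<dots> \<longleftrightarrow> (\<forall>w\<in>?W. 1 \<le> rotation_count first_passage w)"
    using rotation_count_first_passage_le_1 by (metis le_antisym order_refl)
  also have "\<dots> \<longleftrightarrow> fractional_record (- \<alpha>) r"
  proof
    assume ge1: "\<forall>w\<in>?W. 1 \<le> rotation_count first_passage w"
    show "fractional_record (- \<alpha>) r"
      unfolding fractional_record_def
    proof (intro allI impI, rule ccontr)
      fix i assume i: "1 \<le> i \<and> i < r" and "\<not> frac (real r * - \<alpha>) < frac (real i * - \<alpha>)"
      hence le: "frac (real i * - \<alpha>) \<le> frac (real r * - \<alpha>)" by simp
      have "frac (real r * - \<alpha> - real i * - \<alpha>) = frac (real r * - \<alpha>) - frac (real i * - \<alpha>)"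
        using le by (rule frac_diff_pos)
      moreover have "real r * - \<alpha> - real i * - \<alpha> = real (r - i) * - \<alpha>"
        using i by (simp add: of_nat_diff algebra_simps)
      ultimately have "frac (real (r - i) * - \<alpha>) = frac (real r * - \<alpha>) - frac (real i * - \<alpha>)"
        by metis
      moreover have ge: "1 \<le> r - i" "1 \<le> i" using i by linarith+
      \<comment> \<open>Passing from \<open>- \<alpha>\<close> back to \<alpha> leaves an extra 1,
        which makes the lengths \<open>Suc (steps_below _)\<close> additive instead of
        \<open>steps_below\<close>.\<close>
      ultimately have "1 - frac (real (r - i) * \<alpha>) = (1 - frac (real r * \<alpha>)) - (1 - frac (real i * \<alpha>))"
        using frac_mult_pos(2)[OF r] by (simp only: frac_mult_pos(2))
      hence "real (Suc (steps_below i) + Suc (steps_below (r - i))) = real (Suc (steps_below r))"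
        using i by (simp add: steps_below_frac of_nat_diff algebra_simps)
      hence m: "Suc (steps_below i) + Suc (steps_below (r - i)) = Suc (steps_below r)" by linarith
      obtain u v where u: "u \<in> two_letter_words (Suc (steps_below i)) i" "first_passage u"
        and v: "v \<in> two_letter_words (Suc (steps_below (r - i))) (r - i)" "first_passage v"
        using ex_first_passage[OF ge(2)] ex_first_passage[OF ge(1)] by blast
      have "u @ v \<in> ?W"
        using u(1) v(1) i m by (simp add: two_letter_words_def)
      thus False
        using ge1 first_passage_append_no_rotation[OF u(2) v(2)] by blast
    qed
  next
    assume "fractional_record (- \<alpha>) r"
    thus "\<forall>w\<in>?W. 1 \<le> rotation_count first_passage w"
      unfolding rotation_count_pos_iff using ex_rotation_first_passage r by blast
  qed
  finally show ?thesis .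
qed

end

subsection \<open>Admissible words\<close>

text \<open>A rational value would make a power of the odd number \<open>q\<close> equal to a
  positive power of 2.\<close>

lemma log2_odd_irrational:
  assumes "odd q" "q \<ge> 3"
  shows "log 2 (real q) \<notin> \<rat>"
proof
  assume "log 2 (real q) \<in> \<rat>"
  then obtain m n :: nat where mn: "n \<noteq> 0" "\<bar>log 2 (real q)\<bar> = real m / real n"
    by (rule Rats_abs_nat_div_natE)
  have pos: "0 < log 2 (real q)" using assms by simp
  hence "real n * log 2 (real q) = real m" using mn by (simp add: field_simps)
  hence "log 2 (real q ^ n) = real m" using assms by (simp add: log_nat_power)
  hence "2 powr real m = real q ^ n"
    using assms powr_log_cancel[of 2 "real q ^ n"] by simp
  hence "real (q ^ n) = real (2 ^ m)"
    by (simp add: powr_realpow)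
  hence "q ^ n = 2 ^ m" by (simp only: of_nat_eq_iff)
  moreover have "m \<noteq> 0" using mn pos by (intro notI) simp
  ultimately show False using assms(1) by (metis even_power even_numeral gr0I)
qed

definition letter :: "nat \<Rightarrow> bool \<Rightarrow> real" where
  "letter q b = (if b then real q / 2 else 1 / 2)"

lemma (in irrational_slope) prod_list_letters:
  assumes "\<alpha> = log 2 (real q)" "0 < q"
  shows "prod_list (map (letter q) w) = 2 powr height w"
proof (induction w)
  case (Cons x w)
  have "2 powr \<alpha> = real q" using assms by simp
  hence "letter q x = 2 powr height [x]"
    by (simp add: letter_def height_def powr_diff powr_minus divide_simps)
  moreover have "height (x # w) = height [x] + height w"
    using height_append[of "[x]" w] by simp
  ultimately show ?case using Cons by (simp add: powr_add)
qed simp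

text \<open>For \<open>q \<noteq> 1\<close> the two letters differ, so occurrences of
  \<open>q / 2\<close> are exactly those of \<open>True\<close>.\<close>

lemma (in irrational_slope) admissible_map_letter_iff:
  assumes "\<alpha> = log 2 (real q)" "0 < q" "q \<noteq> 1"
  shows "admissible q r (map (letter q) w) \<longleftrightarrow> count_list w True = r \<and> first_passage w"
proof -
  have inj: "inj (letter q)"
    using assms by (auto simp: inj_def letter_def)
  have count: "count_list (map (letter q) w) (real q / 2) = count_list w True"
    using count_list_map_conv[OF inj, of w True] by (simp add: letter_def)
  have "set (map (letter q) w) \<subseteq> {real q / 2, 1 / 2}"
    by (auto simp: letter_def)
  moreover have "prod_list (map (letter q) u) > 1 \<longleftrightarrow> 0 < height u"
      "prod_list (map (letter q) u) < 1 \<longleftrightarrow> height u < 0" for u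
    using powr_less_cancel_iff[of 2 0 "height u"] powr_less_cancel_iff[of 2 "height u" 0]
    by (simp_all add: prod_list_letters[OF assms(1,2)])
  moreover have "(\<forall>l. 1 \<le> l \<and> l < length w \<longrightarrow> 0 < height (take l w)) \<longleftrightarrow>
      (\<forall>u v. w = u @ v \<and> u \<noteq> [] \<and> v \<noteq> [] \<longrightarrow> 0 < height u)"
  proof (intro iffI allI impI)
    fix u v assume "\<forall>l. 1 \<le> l \<and> l < length w \<longrightarrow> 0 < height (take l w)"
      and "w = u @ v \<and> u \<noteq> [] \<and> v \<noteq> []"
    thus "0 < height u" by (auto simp: Suc_le_eq dest!: spec[of _ "length u"])
  next
    fix l assume *: "\<forall>u v. w = u @ v \<and> u \<noteq> [] \<and> v \<noteq> [] \<longrightarrow> 0 < height u"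
      and l: "1 \<le> l \<and> l < length w"
    show "0 < height (take l w)"
      using *[rule_format, of "take l w" "drop l w"] l by (cases "w = []") auto
  qed
  ultimately show ?thesis
    unfolding admissible_def first_passage_def by (simp add: count take_map)
qed

lemma (in irrational_slope) num_admissible_eq:
  assumes "\<alpha> = log 2 (real q)" "0 < q" "q \<noteq> 1" "1 \<le> r"
  shows "num_admissible q r = num_positive r"
proof -
  have inj: "inj (letter q)"
    using assms by (auto simp: inj_def letter_def)
  have "{w. admissible q r w} = map (letter q) ` {w. count_list w True = r \<and> first_passage w}"
  proof (intro equalityI subsetI)
    fix w assume "w \<in> {w. admissible q r w}"
    hence adm: "admissible q r w" by simp
    hence "w \<in> lists (range (letter q))"
      by (force simp: admissible_def letter_def)
    then obtain v where "w = map (letter q) v"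
      by (auto simp: lists_image)
    thus "w \<in> map (letter q) ` {w. count_list w True = r \<and> first_passage w}"
      using adm admissible_map_letter_iff[OF assms(1-3)] by blast
  qed (use admissible_map_letter_iff[OF assms(1-3)] in auto)
  thus ?thesis
    using first_passage_set(2)[OF assms(4)] inj
    by (simp add: num_admissible_def card_image inj_on_subset[OF iffD2[OF inj_map]])
qed

section \<open>From word counts to the equality orders\<close>

lemma eq_binomial_div_iff:
  fixes a n r :: nat
  assumes "1 \<le> r" "1 \<le> n"
  shows "real a = 1 / real r * real ((n - 1) choose (r - 1)) \<longleftrightarrow> n * a = (n choose r)"
proof -
  have "real a = 1 / real r * real ((n - 1) choose (r - 1)) \<longleftrightarrow>
      real (r * a) = real ((n - 1) choose (r - 1))"
    using assms(1) by (simp add: field_simps)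
  also have "\<dots> \<longleftrightarrow> n * (r * a) = n * ((n - 1) choose (r - 1))"
    using assms(2) by (simp only: of_nat_eq_iff mult_cancel1) simp
  \<comment> \<open>This is the absorption identity. The lower bound uses it with
    \<open>n = steps_below r\<close>, the upper one with
    \<open>n = Suc (steps_below r)\<close>.\<close>
  also have "\<dots> \<longleftrightarrow> r * (n * a) = r * (n choose r)"
    using assms(1) by (simp add: times_binomial_minus1_eq mult_ac)
  also have "\<dots> \<longleftrightarrow> n * a = (n choose r)"
    using assms(1) by simp
  finally show ?thesis .
qed

theorem theorem7:
  fixes q :: nat and \<alpha> :: real
  assumes "odd q" and "q \<ge> 3"
  defines "\<alpha> \<equiv> log 2 (real q)"
  shows "int ` lower_equality_orders q =
           {s * cf_den \<alpha> (k + 1) + cf_den \<alpha> k | k s.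
              k \<ge> 1 \<and> odd k \<and> 0 \<le> s \<and> s < cf_coeff \<alpha> (k + 1)}
       \<and> int ` upper_equality_orders q =
           {s * cf_den \<alpha> (k + 1) + cf_den \<alpha> k | k s.
              even k \<and> 0 \<le> s \<and> s < cf_coeff \<alpha> (k + 1) \<and> (k, s) \<noteq> (0, 0)}
       \<and> int ` (lower_equality_orders q \<union> upper_equality_orders q) =
           denominator ` (convergents \<alpha> \<union> semiconvergents \<alpha>)
       \<and> lower_equality_orders q \<inter> upper_equality_orders q = {1}"
proof -
  have "log 2 2 < log 2 (real q)"
    using assms(2) by (subst log_less_cancel_iff) auto
  then interpret irrational_slope \<alpha>
    using log2_odd_irrational[OF assms(1,2)] by unfold_locales (simp_all add: \<alpha>_def)
  have num: "num_admissible q r = num_positive r" if "1 \<le> r" for r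
    using that assms by (intro num_admissible_eq) auto
  have halvings: "max_halvings q r = steps_below r" for r
    by (simp add: max_halvings_def steps_below_def flip: \<alpha>_def)
  have lower: "lower_equality_orders q = {r. 1 \<le> r \<and> fractional_record \<alpha> r}"
  proof -
    have "real (num_admissible q r) = 1 / real r * real ((max_halvings q r - 1) choose (r - 1)) \<longleftrightarrow>
        fractional_record \<alpha> r" if "1 \<le> r" for r
      using eq_binomial_div_iff[OF that, of "steps_below r"] le_steps_below[of r] that
        num_positive_lower_eq_iff[OF that] by (simp add: num halvings)
    thus ?thesis unfolding lower_equality_orders_def by blast
  qed
  have upper: "upper_equality_orders q = {r. 1 \<le> r \<and> fractional_record (- \<alpha>) r}"
  proof -
    have "real (num_admissible q r) = 1 / real r * real (max_halvings q r choose (r - 1)) \<longleftrightarrow>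
        fractional_record (- \<alpha>) r" if "1 \<le> r" for r
      using eq_binomial_div_iff[OF that, of "Suc (steps_below r)"]
        num_positive_upper_eq_iff[OF that] that by (simp add: num halvings)
    thus ?thesis unfolding upper_equality_orders_def by blast
  qed
  have int_image: "int ` {r. 1 \<le> r \<and> P r} = {n. 1 \<le> n \<and> P (nat n)}" for P
  proof (intro equalityI subsetI)
    fix n :: int assume "n \<in> {n. 1 \<le> n \<and> P (nat n)}"
    hence "n = int (nat n)" "nat n \<in> {r. 1 \<le> r \<and> P r}" by auto
    thus "n \<in> int ` {r. 1 \<le> r \<and> P r}" by (rule image_eqI)
  qed auto
  have ge_1_iff: "1 \<le> inter_den k s \<longleftrightarrow> (k, s) \<noteq> (0, 0)" if "0 \<le> s" for k s
    using inter_den_nonneg[OF that, of k] inter_den_eq_0_iff[OF that, of k] by auto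
  have L: "int ` lower_equality_orders q =
      {inter_den k s | k s. k \<ge> 1 \<and> odd k \<and> 0 \<le> s \<and> s < coeff (k + 1)}"
  proof -
    \<comment> \<open>The parameter \<open>p = 1\<close> gives sign +1 and odd \<open>k\<close>; for
      the upper orders, \<open>p = 0\<close> gives sign -1 and even \<open>k\<close>.\<close>
    have "fractional_record \<alpha> (nat n) \<longleftrightarrow>
        (\<exists>k s. odd k \<and> 0 \<le> s \<and> s < coeff (k + 1) \<and> n = inter_den k s)" if "1 \<le> n" for n
      using fractional_record_iff_inter_den[of "nat n" 1] that by simp
    moreover have "1 \<le> k \<and> (k, s) \<noteq> (0, 0)" if "odd k" for k :: nat and s :: int
      using odd_pos[OF that] by simp
    ultimately have "1 \<le> n \<and> fractional_record \<alpha> (nat n) \<longleftrightarrow> (\<exists>k s. n = inter_den k s \<and>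
        k \<ge> 1 \<and> odd k \<and> 0 \<le> s \<and> s < coeff (k + 1))" for n
      using ge_1_iff by metis
    thus ?thesis
      unfolding lower int_image by (simp only:)
  qed
  have U: "int ` upper_equality_orders q =
      {inter_den k s | k s. even k \<and> 0 \<le> s \<and> s < coeff (k + 1) \<and> (k, s) \<noteq> (0, 0)}"
  proof -
    have "fractional_record (- \<alpha>) (nat n) \<longleftrightarrow>
        (\<exists>k s. even k \<and> 0 \<le> s \<and> s < coeff (k + 1) \<and> n = inter_den k s)" if "1 \<le> n" for n
      using fractional_record_iff_inter_den[of "nat n" 0] that by simp
    hence "1 \<le> n \<and> fractional_record (- \<alpha>) (nat n) \<longleftrightarrow> (\<exists>k s. n = inter_den k s \<and>
        even k \<and> 0 \<le> s \<and> s < coeff (k + 1) \<and> (k, s) \<noteq> (0, 0))" for n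
      using ge_1_iff by metis
    thus ?thesis
      unfolding upper int_image by (simp only:)
  qed
  have "int ` (lower_equality_orders q \<union> upper_equality_orders q) =
      denominator ` (convergents \<alpha> \<union> semiconvergents \<alpha>)"
    unfolding denominator_convergents_semiconvergents unfolding image_Un L U
  proof (intro equalityI subsetI)
    fix n assume "n \<in> {inter_den k s | k s. 0 \<le> s \<and> s < coeff (k + 1) \<and> (k, s) \<noteq> (0, 0)}"
    then obtain k s where ks: "n = inter_den k s" "0 \<le> s" "s < coeff (k + 1)" "(k, s) \<noteq> (0, 0)"
      by blast
    show "n \<in> {inter_den k s | k s. k \<ge> 1 \<and> odd k \<and> 0 \<le> s \<and> s < coeff (k + 1)} \<union>
        {inter_den k s | k s. even k \<and> 0 \<le> s \<and> s < coeff (k + 1) \<and> (k, s) \<noteq> (0, 0)}"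
    proof (cases "even k")
      case True
      thus ?thesis using ks by blast
    next
      case False
      hence "k \<ge> 1" by (cases k) auto
      thus ?thesis using ks False by blast
    qed
  next
    fix n assume "n \<in> {inter_den k s | k s. k \<ge> 1 \<and> odd k \<and> 0 \<le> s \<and> s < coeff (k + 1)} \<union>
        {inter_den k s | k s. even k \<and> 0 \<le> s \<and> s < coeff (k + 1) \<and> (k, s) \<noteq> (0, 0)}"
    then obtain k s where "n = inter_den k s" "0 \<le> s" "s < coeff (k + 1)"
        "k \<ge> 1 \<or> (k, s) \<noteq> (0, 0)"
      by blast
    moreover from this(4) have "(k, s) \<noteq> (0, 0)" by auto
    ultimately show "n \<in> {inter_den k s | k s. 0 \<le> s \<and> s < coeff (k + 1) \<and> (k, s) \<noteq> (0, 0)}"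
      by blast
  qed
  moreover have "lower_equality_orders q \<inter> upper_equality_orders q = {1}"
  proof -
    have "r = 1" if r: "1 \<le> r" "fractional_record \<alpha> r" "fractional_record (- \<alpha>) r" for r
    proof (rule ccontr)
      assume "r \<noteq> 1"
      \<comment> \<open>Compare with order 1: the fractional parts for \<alpha> and
        \<open>- \<alpha>\<close> add up to 1 at every positive order, so they cannot both
        decrease.\<close>
      hence "frac (real r * \<alpha>) < frac (real 1 * \<alpha>)" "frac (real r * - \<alpha>) < frac (real 1 * - \<alpha>)"
        using r unfolding fractional_record_def by auto
      thus False
        using frac_mult_pos(2)[of r] frac_mult_pos(2)[of 1] r(1) by simp
    qed
    moreover have "fractional_record \<beta> 1" for \<beta>
      by (simp add: fractional_record_def)
    ultimately show ?thesis unfolding lower upper by auto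
  qed
  ultimately show ?thesis
    using L U unfolding inter_den_def by blast
qed

end
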